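(* Let $\mathbf{J}\sim\mathcal{N}(\mu,C)$ and assume there exist $\eta_0>0$ and $\rho\in(0,1)$ such that $\frac{C(\eta^2/2)}{C(0)}<\rho$ for all $\eta\ge\eta_0$. Then the step sizes of RFD are asymptotically equal to the step sizes of A-RFD, i.e. $$\hat\eta(\Theta)\sim\eta^*(\Theta)\quad\text{as }\Theta\to0,$$ that is, $\eta^*(\Theta)/\hat\eta(\Theta)\to1$ as $\Theta\downarrow0$.
   Context: $\mathbf{J}\sim\mathcal{N}(\mu,C)$ means that $\mathbf{J}$ is a Gaussian random function on $\mathbb{R}^d$ with $\mathbb{E}[\mathbf{J}(w)]=\mu$ and $\operatorname{Cov}(\mathbf{J}(w),\mathbf{J}(\tilde w))=C\bigl(\tfrac{\|w-\tilde w\|^2}{2}\bigr)$. Standing assumptions: $\mathbf{J}$ is differentiable with covariances of derivatives given by the derivatives of the covariance function, $C$ is twice continuously differentiable on $[0,\infty)$, $C(0)>0$, $C'(0)<0$. For $\Theta>0$ define $$q_\Theta(\eta):=-\frac{C(\eta^2/2)}{C(0)}-\eta\,\frac{C'(\eta^2/2)}{C'(0)}\,\Theta,\qquad \eta\in\mathbb{R}.$$ The RFD step size is $\eta^*(\Theta):=\operatorname{argmin}_{\eta\in\mathbb{R}}q_\Theta(\eta)$ (any minimizer, if not unique). The asymptotic RFD (A-RFD) step size is the minimizer of the second order Taylor approximation $T_2q_\Theta$ of $q_\Theta$ around zero, $$\hat\eta(\Theta):=\operatorname{argmin}_\eta T_2q_\Theta(\eta)=\frac{C(0)}{-C'(0)}\,\Theta.$$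 *)

theory Defs
  imports "HOL-Probability.Probability"
begin

section \<open>Gaussian random functions\<close>

definition covariance :: "'a measure \<Rightarrow> ('a \<Rightarrow> real) \<Rightarrow> ('a \<Rightarrow> real) \<Rightarrow> real" where
  "covariance M X Y =
     integral\<^sup>L M (\<lambda>\<omega>. (X \<omega> - integral\<^sup>L M X) * (Y \<omega> - integral\<^sup>L M Y))"

text \<open>The second disjunct is the degenerate normal distribution, of variance zero.\<close>

definition gaussian_rv :: "'a measure \<Rightarrow> ('a \<Rightarrow> real) \<Rightarrow> bool" where
  "gaussian_rv M X \<longleftrightarrow> X \<in> borel_measurable M \<and>
     ((\<exists>m s. s > 0 \<and> distributed M lborel X (normal_density m s)) \<or>
      (\<exists>m. AE \<omega> in M. X \<omega> = m))"

text \<open>All finite-dimensional marginals are multivariate normal, that is, every finite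
  linear combination of the values is (possibly degenerate) normal.\<close>

definition gaussian_random_function :: "'a measure \<Rightarrow> ('w \<Rightarrow> 'a \<Rightarrow> real) \<Rightarrow> bool" where
  "gaussian_random_function M J \<longleftrightarrow>
     (\<forall>W a. finite W \<longrightarrow> gaussian_rv M (\<lambda>\<omega>. \<Sum>w\<in>W. a w * J w \<omega>))"

definition iso_cov :: "(real \<Rightarrow> real) \<Rightarrow> 'w::real_normed_vector \<Rightarrow> 'w \<Rightarrow> real" where
  "iso_cov C w w' = C ((norm (w - w'))\<^sup>2 / 2)"

text \<open>This is \<open>J \<sim> N(\<mu>, C)\<close>.\<close>

definition isotropic_gaussian ::
    "'a measure \<Rightarrow> (real ^ 'd \<Rightarrow> 'a \<Rightarrow> real) \<Rightarrow> real \<Rightarrow> (real \<Rightarrow> real) \<Rightarrow> bool" where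
  "isotropic_gaussian M J \<mu> C \<longleftrightarrow>
     gaussian_random_function M J \<and>
     (\<forall>w. integral\<^sup>L M (J w) = \<mu>) \<and>
     (\<forall>w w'. covariance M (J w) (J w') = iso_cov C w w')"

text \<open>Almost all sample paths of \<open>J\<close> are differentiable everywhere. The field \<open>G\<close> is a
  measurable version of the gradient; it is unconstrained on the exceptional null set.\<close>

definition has_gradient_field ::
    "'a measure \<Rightarrow> (real ^ 'd \<Rightarrow> 'a \<Rightarrow> real) \<Rightarrow> (real ^ 'd \<Rightarrow> 'a \<Rightarrow> real ^ 'd) \<Rightarrow> bool" where
  "has_gradient_field M J G \<longleftrightarrow>
     (\<forall>w. G w \<in> borel_measurable M) \<and>
     (AE \<omega> in M. \<forall>w. ((\<lambda>x. J x \<omega>) has_derivative (\<lambda>v. G w \<omega> \<bullet> v)) (at w))"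

text \<open>The covariances involving directional derivatives of \<open>J\<close> are the corresponding
  directional derivatives of the covariance function of \<open>J\<close>.\<close>

definition derivative_covariances ::
    "'a measure \<Rightarrow> (real ^ 'd \<Rightarrow> 'a \<Rightarrow> real) \<Rightarrow> (real ^ 'd \<Rightarrow> 'a \<Rightarrow> real ^ 'd) \<Rightarrow>
      (real \<Rightarrow> real) \<Rightarrow> bool" where
  "derivative_covariances M J G C \<longleftrightarrow>
     (\<forall>w w' u. covariance M (\<lambda>\<omega>. G w \<omega> \<bullet> u) (J w') =
        deriv (\<lambda>s. iso_cov C (w + s *\<^sub>R u) w') 0) \<and>
     (\<forall>w w' u v. covariance M (\<lambda>\<omega>. G w \<omega> \<bullet> u) (\<lambda>\<omega>. G w' \<omega> \<bullet> v) =
        deriv (\<lambda>s. deriv (\<lambda>t. iso_cov C (w + s *\<^sub>R u) (w' + t *\<^sub>R v)) 0) 0)"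

section \<open>Covariance functions on the half-line\<close>

text \<open>Only the values of \<open>C\<close> on \<open>{0..}\<close> are meaningful, so derivatives are taken within
  \<open>{0..}\<close>; at \<open>0\<close> this is the right derivative.\<close>

definition dhalf :: "(real \<Rightarrow> real) \<Rightarrow> real \<Rightarrow> real" where
  "dhalf C r = vector_derivative C (at r within {0..})"

definition C2_half :: "(real \<Rightarrow> real) \<Rightarrow> bool" where
  "C2_half C \<longleftrightarrow> C differentiable_on {0..} \<and> dhalf C differentiable_on {0..} \<and>
     continuous_on {0..} (dhalf (dhalf C))"

section \<open>Step sizes\<close>

definition q_rfd :: "(real \<Rightarrow> real) \<Rightarrow> real \<Rightarrow> real \<Rightarrow> real" where
  "q_rfd C \<Theta> \<eta> = - (C (\<eta>\<^sup>2 / 2) / C 0) - \<eta> * (dhalf C (\<eta>\<^sup>2 / 2) / dhalf C 0) * \<Theta>"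

definition is_rfd_step :: "(real \<Rightarrow> real) \<Rightarrow> real \<Rightarrow> real \<Rightarrow> bool" where
  "is_rfd_step C \<Theta> \<eta> \<longleftrightarrow> is_arg_min (q_rfd C \<Theta>) (\<lambda>_. True) \<eta>"

definition taylor2_at_0 :: "(real \<Rightarrow> real) \<Rightarrow> real \<Rightarrow> real" where
  "taylor2_at_0 f x = f 0 + deriv f 0 * x + deriv (deriv f) 0 / 2 * x\<^sup>2"

text \<open>The minimizer is unique under the standing assumptions on \<open>C\<close>: there
  \<open>taylor2_at_0 (q_rfd C \<Theta>)\<close> is \<open>\<lambda>\<eta>. - 1 - \<Theta> * \<eta> + (- C'(0) / C(0)) / 2 * \<eta>\<^sup>2\<close>.\<close>

definition arfd_step :: "(real \<Rightarrow> real) \<Rightarrow> real \<Rightarrow> real" where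
  "arfd_step C \<Theta> = arg_min (taylor2_at_0 (q_rfd C \<Theta>)) (\<lambda>_. True)"

end

theory Submission
  imports Defs
begin

text \<open>
  Write \<open>r = \<eta>\<^sup>2 / 2\<close>. Since \<open>q_rfd C \<Theta> 0 = - 1\<close>, a step \<open>\<eta>\<close> can compete with the step \<open>0\<close>
  only if the gain \<open>\<eta> C'(r) / C'(0) \<Theta>\<close> makes up for the loss \<open>1 - C(r) / C(0)\<close>. That
  \<open>C\<close> is a covariance function bounds the gain from above and the loss from below.
  By the Cauchy-Schwarz inequality for the covariance of the field and its derivative,
  \<open>(\<eta> C'(r))\<^sup>2 \<le> - C'(0) C(0)\<close> for every \<open>\<eta>\<close>, so that the gain is \<open>O(\<Theta>)\<close> uniformly in \<open>\<eta>\<close>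
  (\<open>slope_bounded\<close>). And \<open>C(r) < C(0)\<close> for \<open>r > 0\<close> (\<open>covariance_lt_variance\<close>): otherwise
  the field would almost surely not change along steps of length \<open>\<eta>\<close>, hence along any
  number of such steps, and \<open>C\<close> would return to \<open>C(0)\<close> arbitrarily far out, against the
  bound by \<open>\<rho>\<close>. Together with that bound and compactness, the loss is bounded away
  from \<open>0\<close> outside each neighbourhood of \<open>0\<close>. So for small \<open>\<Theta>\<close> the minimizers lie in the
  given neighbourhood (\<open>q_rfd_gt_away_from_0\<close>), and they exist because a continuous function
  attains its minimum on a compact interval.

  A minimizer is a critical point, and \<open>q_rfd C \<Theta>'(\<eta>) = 0\<close> can be rewritten as
  \<open>\<eta> = \<eta>' (C'(r) + \<eta>\<^sup>2 C''(r)) / C'(r)\<close> with \<open>\<eta>' = - \<Theta> C(0) / C'(0)\<close> the asymptotic step.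
  As the minimizers tend to \<open>0\<close>, the last factor tends to \<open>1\<close>.
\<close>

section \<open>Covariances\<close>

text \<open>A nonzero variance certifies square integrability, because the integral of a
  non-integrable function is \<open>0\<close>; for the same reason a covariance whose integrand is
  not integrable satisfies the inequality trivially.\<close>

lemma covariance_Cauchy_Schwarz:
  assumes X: "covariance M X X > 0" and Y: "covariance M Y Y > 0"
  shows "(covariance M X Y)\<^sup>2 \<le> covariance M X X * covariance M Y Y"
proof -
  define f where "f = (\<lambda>\<omega>. X \<omega> - integral\<^sup>L M X)"
  define g where "g = (\<lambda>\<omega>. Y \<omega> - integral\<^sup>L M Y)"
  define F where "F = covariance M X X"
  define A where "A = covariance M Y Y"
  define c where "c = covariance M X Y"
  have F: "F = (\<integral>\<omega>. f \<omega> * f \<omega> \<partial>M)" and A: "A = (\<integral>\<omega>. g \<omega> * g \<omega> \<partial>M)"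
    and c: "c = (\<integral>\<omega>. f \<omega> * g \<omega> \<partial>M)"
    by (simp_all add: F_def A_def c_def covariance_def f_def g_def)
  have pos: "F > 0" "A > 0" using X Y by (simp_all add: F_def A_def)
  have iF: "integrable M (\<lambda>\<omega>. f \<omega> * f \<omega>)" and iA: "integrable M (\<lambda>\<omega>. g \<omega> * g \<omega>)"
    using pos F A not_integrable_integral_eq by (metis less_irrefl)+
  have "c\<^sup>2 \<le> F * A"
  proof (cases "integrable M (\<lambda>\<omega>. f \<omega> * g \<omega>)")
    case True
    have "0 \<le> (\<integral>\<omega>. (A * f \<omega> - c * g \<omega>)\<^sup>2 \<partial>M)"
      by simp
    also have "\<dots> = (\<integral>\<omega>. A\<^sup>2 * (f \<omega> * f \<omega>) - 2 * A * c * (f \<omega> * g \<omega>) + c\<^sup>2 * (g \<omega> * g \<omega>) \<partial>M)"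
      by (simp add: power2_eq_square algebra_simps)
    also have "\<dots> = A\<^sup>2 * F - 2 * A * c * c + c\<^sup>2 * A"
      using True iF iA by (simp add: F A c)
    also have "\<dots> = A * (F * A - c\<^sup>2)"
      by (simp add: power2_eq_square algebra_simps)
    finally show ?thesis
      using pos by (simp add: zero_le_mult_iff)
  next
    case False
    then have "c = 0"
      by (simp add: c not_integrable_integral_eq)
    with pos show ?thesis by simp
  qed
  then show ?thesis by (simp add: F_def A_def c_def)
qed

text \<open>Equality in the Cauchy-Schwarz inequality: \<open>X - Y\<close> then has variance \<open>0\<close>.\<close>

lemma centered_AE_eq_if_covariance_eq_variance:
  assumes X: "covariance M X X = v" and Y: "covariance M Y Y = v"
    and XY: "covariance M X Y = v" and v: "v > 0"
  shows "AE \<omega> in M. X \<omega> - integral\<^sup>L M X = Y \<omega> - integral\<^sup>L M Y"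
proof -
  define f where "f = (\<lambda>\<omega>. X \<omega> - integral\<^sup>L M X)"
  define g where "g = (\<lambda>\<omega>. Y \<omega> - integral\<^sup>L M Y)"
  have F: "v = (\<integral>\<omega>. f \<omega> * f \<omega> \<partial>M)" and A: "v = (\<integral>\<omega>. g \<omega> * g \<omega> \<partial>M)"
    and c: "v = (\<integral>\<omega>. f \<omega> * g \<omega> \<partial>M)"
    using X Y XY by (simp_all add: covariance_def f_def g_def)
  have int: "integrable M (\<lambda>\<omega>. f \<omega> * f \<omega>)" "integrable M (\<lambda>\<omega>. g \<omega> * g \<omega>)"
    "integrable M (\<lambda>\<omega>. f \<omega> * g \<omega>)"
    using v F A c not_integrable_integral_eq by (metis less_irrefl)+
  have sq: "(f \<omega> - g \<omega>)\<^sup>2 = f \<omega> * f \<omega> - 2 * (f \<omega> * g \<omega>) + g \<omega> * g \<omega>" for \<omega>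
    by (simp add: power2_eq_square algebra_simps)
  have "integrable M (\<lambda>\<omega>. (f \<omega> - g \<omega>)\<^sup>2)"
    unfolding sq using int by simp
  moreover have "(\<integral>\<omega>. (f \<omega> - g \<omega>)\<^sup>2 \<partial>M) = 0"
    unfolding sq using int by (simp flip: F A c)
  ultimately have "AE \<omega> in M. (f \<omega> - g \<omega>)\<^sup>2 = 0"
    by (subst (asm) integral_nonneg_eq_0_iff_AE) auto
  then show ?thesis
    by (simp add: f_def g_def)
qed

section \<open>Functions of half the squared distance\<close>

lemma DERIV_dhalf:
  assumes "C differentiable_on {0..}" "0 \<le> r"
  shows "(C has_real_derivative dhalf C r) (at r within {0..})"
  using assms
  by (simp add: differentiable_on_def dhalf_def has_real_derivative_iff_has_vector_derivative
      flip: vector_derivative_works)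

text \<open>Squaring maps into \<open>{0..}\<close>, so one-sided differentiability of \<open>f\<close> at \<open>0\<close> suffices
  for two-sided differentiability of the composition.\<close>

lemma DERIV_half_square:
  assumes "f differentiable_on {0..}"
  shows "((\<lambda>x. f (x\<^sup>2 / 2)) has_real_derivative x * dhalf f (x\<^sup>2 / 2)) (at x)"
proof -
  have "(f has_real_derivative dhalf f (x\<^sup>2 / 2)) (at (x\<^sup>2 / 2) within range (\<lambda>x::real. x\<^sup>2 / 2))"
    by (rule DERIV_subset[OF DERIV_dhalf[OF assms]]) auto
  moreover have "((\<lambda>x::real. x\<^sup>2 / 2) has_real_derivative x) (at x)"
    by (auto intro!: derivative_eq_intros)
  ultimately have "((f \<circ> (\<lambda>x. x\<^sup>2 / 2)) has_real_derivative dhalf f (x\<^sup>2 / 2) * x) (at x)"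
    by (rule DERIV_image_chain)
  then show ?thesis by (simp add: o_def mult.commute)
qed

lemma continuous_on_half_square:
  assumes "continuous_on {0..} f"
  shows "continuous_on UNIV (\<lambda>x::real. f (x\<^sup>2 / 2) :: real)"
  by (rule continuous_on_compose2[OF assms]) (auto intro!: continuous_intros)

lemma C2_half_continuous:
  assumes "C2_half C"
  shows "continuous_on {0..} C" "continuous_on {0..} (dhalf C)"
    "continuous_on {0..} (dhalf (dhalf C))"
  using assms by (auto simp: C2_half_def intro: differentiable_imp_continuous_on)

section \<open>Bounds on the covariance function of a random field\<close>

lemma iso_cov_line:
  assumes "norm u = 1"
  shows "iso_cov C (a *\<^sub>R u) (b *\<^sub>R u) = C ((a - b)\<^sup>2 / 2)"
  using assms by (simp add: iso_cov_def flip: scaleR_diff_left)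

text \<open>On a line with unit direction \<open>u\<close>, the derivative of the field at distance \<open>\<eta>\<close> has
  covariance \<open>\<eta> C'(\<eta>\<^sup>2 / 2)\<close> with the field at the origin, and its variance is \<open>- C'(0)\<close>;
  the bound is the Cauchy-Schwarz inequality for these two variables.\<close>

lemma slope_bounded:
  fixes J :: "real ^ 'd \<Rightarrow> 'a \<Rightarrow> real"
  assumes J: "isotropic_gaussian M J \<mu> C"
    and G: "derivative_covariances M J G C"
    and C2: "C2_half C" and C0: "C 0 > 0" and C'0: "dhalf C 0 < 0"
  shows "(\<eta> * dhalf C (\<eta>\<^sup>2 / 2))\<^sup>2 \<le> - dhalf C 0 * C 0"
proof -
  obtain u :: "real ^ 'd" where u: "norm u = 1"
    using vector_choose_size[of 1] by auto
  have diff: "C differentiable_on {0..}" "dhalf C differentiable_on {0..}"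
    using C2 by (auto simp: C2_half_def)
  define X where "X = (\<lambda>w \<omega>. G w \<omega> \<bullet> u)"
  have XJ: "covariance M (X (\<eta> *\<^sub>R u)) (J 0) = \<eta> * dhalf C (\<eta>\<^sup>2 / 2)" for \<eta>
  proof -
    have "iso_cov C (\<eta> *\<^sub>R u + s *\<^sub>R u) 0 = C ((\<eta> + s)\<^sup>2 / 2)" for s
      using iso_cov_line[OF u, of C "\<eta> + s" 0] by (simp add: scaleR_add_left)
    moreover have "((\<lambda>s. C ((\<eta> + s)\<^sup>2 / 2)) has_real_derivative \<eta> * dhalf C (\<eta>\<^sup>2 / 2)) (at 0)"
      using DERIV_half_square[OF diff(1), of \<eta>] DERIV_shift[of "\<lambda>x. C (x\<^sup>2 / 2)" _ 0 \<eta>]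
      by (simp add: add.commute)
    ultimately show ?thesis
      using G by (simp add: derivative_covariances_def X_def DERIV_imp_deriv)
  qed
  have XX: "covariance M (X w) (X w) = - dhalf C 0" for w
  proof -
    have "iso_cov C (w + s *\<^sub>R u) (w + t *\<^sub>R u) = C ((t - s)\<^sup>2 / 2)" for s t
      using iso_cov_line[OF u, of C s t] by (simp add: iso_cov_def power2_commute)
    moreover have "deriv (\<lambda>t. C ((t - s)\<^sup>2 / 2)) 0 = - s * dhalf C (s\<^sup>2 / 2)" for s
    proof (rule DERIV_imp_deriv)
      show "((\<lambda>t. C ((t - s)\<^sup>2 / 2)) has_real_derivative - s * dhalf C (s\<^sup>2 / 2)) (at 0)"
        using DERIV_half_square[OF diff(1), of "- s"] DERIV_shift[of "\<lambda>x. C (x\<^sup>2 / 2)" _ 0 "- s"]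
        by simp
    qed
    moreover have "((\<lambda>s. - s * dhalf C (s\<^sup>2 / 2)) has_real_derivative - dhalf C 0) (at 0)"
      by (rule derivative_eq_intros DERIV_half_square[OF diff(2)] refl)+ simp
    ultimately show ?thesis
      using G by (simp add: derivative_covariances_def X_def DERIV_imp_deriv)
  qed
  have JJ: "covariance M (J 0) (J 0) = C 0"
    using J by (simp add: isotropic_gaussian_def iso_cov_def)
  show ?thesis
    using covariance_Cauchy_Schwarz[of M "X (\<eta> *\<^sub>R u)" "J 0"] C0 C'0 by (simp add: XX JJ XJ)
qed

lemma covariance_le_variance:
  fixes J :: "real ^ 'd \<Rightarrow> 'a \<Rightarrow> real"
  assumes J: "isotropic_gaussian M J \<mu> C" and C0: "C 0 > 0"
  shows "C (\<eta>\<^sup>2 / 2) \<le> C 0"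
proof -
  obtain u :: "real ^ 'd" where u: "norm u = 1"
    using vector_choose_size[of 1] by auto
  have cov: "covariance M (J (a *\<^sub>R u)) (J (b *\<^sub>R u)) = C ((a - b)\<^sup>2 / 2)" for a b
    using J iso_cov_line[OF u] by (simp add: isotropic_gaussian_def)
  have "(C (\<eta>\<^sup>2 / 2))\<^sup>2 \<le> (C 0)\<^sup>2"
    using covariance_Cauchy_Schwarz[of M "J (\<eta> *\<^sub>R u)" "J (0 *\<^sub>R u)"] C0
    by (simp add: cov power2_eq_square del: scaleR_zero_left)
  then show ?thesis
    using C0 by (simp add: abs_le_square_iff[symmetric])
qed

text \<open>Along a line, a field that is perfectly correlated at distance \<open>\<eta>\<close> almost surely takes
  the same centered value at both ends of a step of length \<open>\<eta>\<close>, hence of \<open>n\<close> such steps.\<close>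

lemma covariance_recurrent:
  fixes J :: "real ^ 'd \<Rightarrow> 'a \<Rightarrow> real"
  assumes J: "isotropic_gaussian M J \<mu> C" and C0: "C 0 > 0"
    and eq: "C (\<eta>\<^sup>2 / 2) = C 0"
  shows "C ((of_nat n * \<eta>)\<^sup>2 / 2) = C 0"
proof -
  obtain u :: "real ^ 'd" where u: "norm u = 1"
    using vector_choose_size[of 1] by auto
  have cov: "covariance M (J (a *\<^sub>R u)) (J (b *\<^sub>R u)) = C ((a - b)\<^sup>2 / 2)" for a b
    using J iso_cov_line[OF u] by (simp add: isotropic_gaussian_def)
  define X where "X = (\<lambda>k::nat. J ((of_nat k * \<eta>) *\<^sub>R u))"
  define Z where "Z = (\<lambda>k \<omega>. X k \<omega> - integral\<^sup>L M (X k))"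
  have covX: "covariance M (X k) (X l) = C ((of_nat k * \<eta> - of_nat l * \<eta>)\<^sup>2 / 2)" for k l
    by (simp add: X_def cov)
  have step: "AE \<omega> in M. Z k \<omega> = Z (Suc k) \<omega>" for k
    unfolding Z_def
    by (rule centered_AE_eq_if_covariance_eq_variance[where v = "C 0"])
      (simp_all add: covX C0 eq algebra_simps)
  have meas: "X k \<in> borel_measurable M" for k
  proof -
    have "gaussian_rv M (\<lambda>\<omega>. \<Sum>w\<in>{(of_nat k * \<eta>) *\<^sub>R u}. 1 * J w \<omega>)"
      using J unfolding isotropic_gaussian_def gaussian_random_function_def
      by (elim conjE allE) (erule mp, simp)
    then show ?thesis by (simp add: gaussian_rv_def X_def)
  qed
  have Z: "AE \<omega> in M. Z n \<omega> = Z 0 \<omega>" for n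
  proof (induction n)
    case (Suc n)
    with step[of n] show ?case by eventually_elim simp
  qed simp
  have "C ((of_nat n * \<eta>)\<^sup>2 / 2) = covariance M (X n) (X 0)"
    by (simp add: covX)
  also have "\<dots> = (\<integral>\<omega>. Z n \<omega> * Z 0 \<omega> \<partial>M)"
    by (simp add: covariance_def Z_def)
  also have "\<dots> = (\<integral>\<omega>. Z 0 \<omega> * Z 0 \<omega> \<partial>M)"
  proof (rule integral_cong_AE)
    show "AE \<omega> in M. Z n \<omega> * Z 0 \<omega> = Z 0 \<omega> * Z 0 \<omega>"
      using Z[of n] by eventually_elim simp
  qed (use meas in \<open>simp_all add: Z_def\<close>)
  also have "\<dots> = covariance M (X 0) (X 0)"
    by (simp add: covariance_def Z_def)
  also have "\<dots> = C 0"
    by (simp add: covX)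
  finally show ?thesis .
qed

lemma covariance_lt_variance:
  fixes J :: "real ^ 'd \<Rightarrow> 'a \<Rightarrow> real"
  assumes J: "isotropic_gaussian M J \<mu> C" and C0: "C 0 > 0"
    and \<rho>: "\<rho> < 1" and decay: "\<And>\<eta>. \<eta> \<ge> \<eta>0 \<Longrightarrow> C (\<eta>\<^sup>2 / 2) / C 0 < \<rho>"
    and \<eta>: "\<eta> > 0"
  shows "C (\<eta>\<^sup>2 / 2) < C 0"
proof (rule ccontr)
  assume "\<not> ?thesis"
  with covariance_le_variance[OF J C0, of \<eta>] have eq: "C (\<eta>\<^sup>2 / 2) = C 0" by simp
  obtain n where "\<eta>0 < of_nat n * \<eta>"
    using ex_less_of_nat_mult[OF \<eta>] by blast
  then have "C ((of_nat n * \<eta>)\<^sup>2 / 2) / C 0 < \<rho>"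
    by (intro decay) simp
  with covariance_recurrent[OF J C0 eq, of n] C0 \<rho> show False by simp
qed

section \<open>Minimizers of the step size objective\<close>

lemma correlation_bounded_away_from_1:
  fixes \<epsilon> \<eta>0 \<rho> :: real
  assumes cont: "continuous_on {0..} C" and C0: "C 0 > 0"
    and lt: "\<And>\<eta>. \<eta> > 0 \<Longrightarrow> C (\<eta>\<^sup>2 / 2) < C 0"
    and \<rho>: "\<rho> < 1" and decay: "\<And>\<eta>. \<eta> \<ge> \<eta>0 \<Longrightarrow> C (\<eta>\<^sup>2 / 2) / C 0 < \<rho>"
    and \<epsilon>: "\<epsilon> > 0"
  obtains m where "m < 1" "\<And>\<eta>. \<epsilon> \<le> \<bar>\<eta>\<bar> \<Longrightarrow> C (\<eta>\<^sup>2 / 2) / C 0 \<le> m"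
proof -
  \<comment> \<open>The interval is extended beyond \<open>\<epsilon>\<close> to make it nonempty also when \<open>\<eta>0 < \<epsilon>\<close>.\<close>
  have "continuous_on {\<epsilon>..max \<epsilon> \<eta>0} (\<lambda>\<eta>. C (\<eta>\<^sup>2 / 2) / C 0)"
    using continuous_on_half_square[OF cont] C0
    by (auto intro!: continuous_intros intro: continuous_on_subset)
  then obtain x where x: "x \<in> {\<epsilon>..max \<epsilon> \<eta>0}"
    and max: "\<And>\<eta>. \<eta> \<in> {\<epsilon>..max \<epsilon> \<eta>0} \<Longrightarrow> C (\<eta>\<^sup>2 / 2) / C 0 \<le> C (x\<^sup>2 / 2) / C 0"
    using continuous_attains_sup[of "{\<epsilon>..max \<epsilon> \<eta>0}" "\<lambda>\<eta>. C (\<eta>\<^sup>2 / 2) / C 0"] by auto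
  show thesis
  proof (rule that)
    show "max \<rho> (C (x\<^sup>2 / 2) / C 0) < 1"
      using x lt[of x] \<rho> \<epsilon> C0 by simp
    show "C (\<eta>\<^sup>2 / 2) / C 0 \<le> max \<rho> (C (x\<^sup>2 / 2) / C 0)" if "\<epsilon> \<le> \<bar>\<eta>\<bar>" for \<eta>
      using decay[of "\<bar>\<eta>\<bar>"] max[of "\<bar>\<eta>\<bar>"] that by (cases "\<bar>\<eta>\<bar> \<ge> \<eta>0") auto
  qed
qed

text \<open>The bound \<open>- 1\<close> is the value of the objective at the step \<open>0\<close>, which therefore beats
  every step of length at least \<open>\<epsilon>\<close>: the loss there is at least some \<open>1 - m > 0\<close>, while
  the gain is at most a constant times \<open>\<Theta>\<close>.\<close>

lemma q_rfd_gt_away_from_0: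
  fixes \<epsilon> \<eta>0 \<rho> K :: real
  assumes cont: "continuous_on {0..} C" and C0: "C 0 > 0"
    and lt: "\<And>\<eta>. \<eta> > 0 \<Longrightarrow> C (\<eta>\<^sup>2 / 2) < C 0"
    and \<rho>: "\<rho> < 1" and decay: "\<And>\<eta>. \<eta> \<ge> \<eta>0 \<Longrightarrow> C (\<eta>\<^sup>2 / 2) / C 0 < \<rho>"
    and slope: "\<And>\<eta>. (\<eta> * dhalf C (\<eta>\<^sup>2 / 2))\<^sup>2 \<le> K"
    and \<epsilon>: "\<epsilon> > 0"
  shows "\<forall>\<^sub>F \<Theta> in at_right 0. \<forall>\<eta>. \<epsilon> \<le> \<bar>\<eta>\<bar> \<longrightarrow> q_rfd C \<Theta> \<eta> > - 1"
proof -
  obtain m where m: "m < 1" "\<And>\<eta>. \<epsilon> \<le> \<bar>\<eta>\<bar> \<Longrightarrow> C (\<eta>\<^sup>2 / 2) / C 0 \<le> m"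
    using correlation_bounded_away_from_1[OF cont C0 lt \<rho> decay \<epsilon>] by metis
  define L where "L = sqrt K / \<bar>dhalf C 0\<bar>"
  have gain: "\<eta> * (dhalf C (\<eta>\<^sup>2 / 2) / dhalf C 0) \<le> L" for \<eta>
  proof -
    have "\<bar>\<eta> * dhalf C (\<eta>\<^sup>2 / 2)\<bar> \<le> sqrt K"
      using real_sqrt_le_mono[OF slope[of \<eta>]] by simp
    then have "\<bar>\<eta> * dhalf C (\<eta>\<^sup>2 / 2)\<bar> / \<bar>dhalf C 0\<bar> \<le> L"
      unfolding L_def by (rule divide_right_mono) simp
    moreover have "\<eta> * (dhalf C (\<eta>\<^sup>2 / 2) / dhalf C 0)
        \<le> \<bar>\<eta> * dhalf C (\<eta>\<^sup>2 / 2)\<bar> / \<bar>dhalf C 0\<bar>"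
      using abs_ge_self[of "\<eta> * (dhalf C (\<eta>\<^sup>2 / 2) / dhalf C 0)"] by (simp add: abs_mult)
    ultimately show ?thesis by linarith
  qed
  have "((\<lambda>\<Theta>. L * \<Theta>) \<longlongrightarrow> 0) (at_right 0)"
    by (auto intro!: tendsto_eq_intros)
  then have "\<forall>\<^sub>F \<Theta> in at_right 0. L * \<Theta> < 1 - m"
    by (rule order_tendstoD(2)) (use m(1) in simp)
  moreover have "\<forall>\<^sub>F \<Theta>::real in at_right 0. \<Theta> > 0"
    by (simp add: eventually_at_filter)
  ultimately show ?thesis
  proof eventually_elim
    case (elim \<Theta>)
    show ?case
    proof (intro allI impI)
      fix \<eta> assume "\<epsilon> \<le> \<bar>\<eta>\<bar>"
      with m(2) have "C (\<eta>\<^sup>2 / 2) / C 0 \<le> m" by blast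
      moreover have "\<eta> * (dhalf C (\<eta>\<^sup>2 / 2) / dhalf C 0) * \<Theta> \<le> L * \<Theta>"
        using gain[of \<eta>] elim(2) by (intro mult_right_mono) auto
      ultimately show "q_rfd C \<Theta> \<eta> > - 1"
        using elim(1) by (simp add: q_rfd_def)
    qed
  qed
qed

lemma q_rfd_0: "C 0 \<noteq> 0 \<Longrightarrow> q_rfd C \<Theta> 0 = - 1"
  by (simp add: q_rfd_def)

lemma ex_rfd_step:
  assumes C2: "C2_half C" and C0: "C 0 > 0"
    and far: "\<And>\<eta>. \<epsilon> \<le> \<bar>\<eta>\<bar> \<Longrightarrow> q_rfd C \<Theta> \<eta> > - 1" and \<epsilon>: "\<epsilon> > 0"
  shows "\<exists>\<eta>. is_rfd_step C \<Theta> \<eta>"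
proof -
  have "continuous_on {-\<epsilon>..\<epsilon>} (q_rfd C \<Theta>)"
    unfolding q_rfd_def divide_inverse
    by (intro continuous_intros continuous_on_half_square[THEN continuous_on_subset,
          unfolded divide_inverse] C2_half_continuous[OF C2]) auto
  then obtain x where x: "\<And>\<eta>. \<eta> \<in> {-\<epsilon>..\<epsilon>} \<Longrightarrow> q_rfd C \<Theta> x \<le> q_rfd C \<Theta> \<eta>"
    using continuous_attains_inf[of "{-\<epsilon>..\<epsilon>}" "q_rfd C \<Theta>"] \<epsilon>
    by (metis atLeastAtMost_iff compact_Icc empty_iff neg_le_0_iff_le less_imp_le)
  have "q_rfd C \<Theta> x \<le> q_rfd C \<Theta> \<eta>" for \<eta>
  proof (cases "\<eta> \<in> {-\<epsilon>..\<epsilon>}")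
    case False
    then have "- 1 < q_rfd C \<Theta> \<eta>" by (intro far) auto
    with x[of 0] q_rfd_0[of C \<Theta>] C0 \<epsilon> show ?thesis by simp
  qed (rule x)
  then show ?thesis
    by (auto simp: is_rfd_step_def is_arg_min_def not_less)
qed

lemma DERIV_q_rfd:
  assumes C2: "C2_half C"
  shows "(q_rfd C \<Theta> has_real_derivative
      - (\<eta> * dhalf C (\<eta>\<^sup>2 / 2)) / C 0
      - (dhalf C (\<eta>\<^sup>2 / 2) + \<eta> * (\<eta> * dhalf (dhalf C) (\<eta>\<^sup>2 / 2))) / dhalf C 0 * \<Theta>) (at \<eta>)"
proof -
  have diff: "C differentiable_on {0..}" "dhalf C differentiable_on {0..}"
    using C2 by (auto simp: C2_half_def)
  have "((\<lambda>\<eta>. - (C (\<eta>\<^sup>2 / 2) / C 0) - \<eta> * (dhalf C (\<eta>\<^sup>2 / 2) / dhalf C 0) * \<Theta>)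
      has_real_derivative
      - (\<eta> * dhalf C (\<eta>\<^sup>2 / 2) / C 0)
      - (1 * (dhalf C (\<eta>\<^sup>2 / 2) / dhalf C 0) + (\<eta> * dhalf (dhalf C) (\<eta>\<^sup>2 / 2) / dhalf C 0) * \<eta>) * \<Theta>)
      (at \<eta>)"
    by (intro DERIV_diff DERIV_minus DERIV_cdivide DERIV_half_square diff DERIV_cmult_right
        DERIV_mult DERIV_ident)
  then show ?thesis
    unfolding q_rfd_def by (rule DERIV_cong) (simp add: algebra_simps add_divide_distrib)
qed

text \<open>Away from \<open>0\<close> the second derivative need not exist, since \<open>C''\<close> is merely continuous.
  At \<open>0\<close> it does, because \<open>C''\<close> enters \<open>q_rfd C \<Theta>'\<close> with the factor \<open>\<eta>\<^sup>2\<close>.\<close>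

lemma DERIV2_q_rfd_0:
  assumes C2: "C2_half C"
  shows "deriv (deriv (q_rfd C \<Theta>)) 0 = - dhalf C 0 / C 0"
proof (rule DERIV_imp_deriv)
  have diff: "dhalf C differentiable_on {0..}"
    using C2 by (auto simp: C2_half_def)
  have "isCont (\<lambda>\<eta>. \<eta> * dhalf (dhalf C) (\<eta>\<^sup>2 / 2)) 0"
    using continuous_on_half_square[OF C2_half_continuous(3)[OF C2]]
    by (intro continuous_intros) (simp add: continuous_on_eq_continuous_at)
  then have sq: "((\<lambda>\<eta>. \<eta> * (\<eta> * dhalf (dhalf C) (\<eta>\<^sup>2 / 2))) has_real_derivative 0) (at 0)"
    by (subst CARAT_DERIV) (auto intro!: exI[of _ "\<lambda>\<eta>. \<eta> * dhalf (dhalf C) (\<eta>\<^sup>2 / 2)"])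
  have "deriv (q_rfd C \<Theta>) = (\<lambda>\<eta>. - (\<eta> * dhalf C (\<eta>\<^sup>2 / 2)) / C 0
      - (dhalf C (\<eta>\<^sup>2 / 2) + \<eta> * (\<eta> * dhalf (dhalf C) (\<eta>\<^sup>2 / 2))) / dhalf C 0 * \<Theta>)"
    by (rule ext, rule DERIV_imp_deriv, rule DERIV_q_rfd[OF C2])
  moreover have "((\<lambda>\<eta>. - (\<eta> * dhalf C (\<eta>\<^sup>2 / 2)) / C 0
      - (dhalf C (\<eta>\<^sup>2 / 2) + \<eta> * (\<eta> * dhalf (dhalf C) (\<eta>\<^sup>2 / 2))) / dhalf C 0 * \<Theta>)
      has_real_derivative
      - (1 * dhalf C (0\<^sup>2 / 2) + (0 * dhalf (dhalf C) (0\<^sup>2 / 2)) * 0) / C 0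
      - (0 * dhalf (dhalf C) (0\<^sup>2 / 2) + 0) / dhalf C 0 * \<Theta>) (at 0)"
    by (intro DERIV_diff DERIV_minus DERIV_cdivide DERIV_half_square diff DERIV_cmult_right
        DERIV_mult DERIV_ident DERIV_add sq)
  ultimately show "(deriv (q_rfd C \<Theta>) has_real_derivative - dhalf C 0 / C 0) (at 0)"
    by simp
qed

lemma arg_min_quadratic:
  fixes a b c :: real
  assumes "a > 0"
  shows "arg_min (\<lambda>x. c - b * x + a / 2 * x\<^sup>2) (\<lambda>_. True) = b / a"
proof -
  have "c - b * x + a / 2 * x\<^sup>2 = c - b\<^sup>2 / (2 * a) + a / 2 * (x - b / a)\<^sup>2" for x
    using assms by (simp add: field_simps power2_eq_square)
  then have eq: "(\<lambda>x. c - b * x + a / 2 * x\<^sup>2) = (\<lambda>x. c - b\<^sup>2 / (2 * a) + a / 2 * (x - b / a)\<^sup>2)"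
    by blast
  show ?thesis
    unfolding eq
  proof (rule arg_minI[where x = "b / a"])
    fix x assume "\<forall>y. True \<longrightarrow> \<not> c - b\<^sup>2 / (2 * a) + a / 2 * (y - b / a)\<^sup>2
      < c - b\<^sup>2 / (2 * a) + a / 2 * (x - b / a)\<^sup>2"
    then have "a / 2 * (x - b / a)\<^sup>2 \<le> 0"
      by (auto dest: spec[of _ "b / a"])
    with assms show "x = b / a"
      by (simp add: mult_le_0_iff)
  qed (use assms in \<open>auto simp: not_less\<close>)
qed

lemma arfd_step_eq:
  assumes C2: "C2_half C" and C0: "C 0 > 0" and C'0: "dhalf C 0 < 0"
  shows "arfd_step C \<Theta> = \<Theta> * C 0 / - dhalf C 0"
proof -
  have "deriv (q_rfd C \<Theta>) 0 = - \<Theta>"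
    using DERIV_imp_deriv[OF DERIV_q_rfd[OF C2, of \<Theta> 0]] C'0 by simp
  then have "taylor2_at_0 (q_rfd C \<Theta>) = (\<lambda>x. - 1 - \<Theta> * x + (- dhalf C 0 / C 0) / 2 * x\<^sup>2)"
    using C0 by (simp add: taylor2_at_0_def DERIV2_q_rfd_0[OF C2] q_rfd_0 fun_eq_iff)
  moreover have "- dhalf C 0 / C 0 > 0"
    using C0 C'0 by (simp add: divide_neg_pos)
  ultimately show ?thesis
    unfolding arfd_step_def by (simp only: arg_min_quadratic) simp
qed

text \<open>This rearranges the critical point equation \<open>q_rfd C \<Theta>'(\<eta>) = 0\<close> so that the right-hand
  side depends on \<open>\<Theta>\<close> only through \<open>\<eta>\<close> and is continuous at \<open>\<eta> = 0\<close> with value \<open>1\<close>.\<close>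

lemma rfd_step_ratio:
  assumes C2: "C2_half C" and C0: "C 0 > 0" and C'0: "dhalf C 0 < 0"
    and \<Theta>: "\<Theta> > 0" and step: "is_rfd_step C \<Theta> \<eta>" and nz: "dhalf C (\<eta>\<^sup>2 / 2) \<noteq> 0"
  shows "\<eta> / arfd_step C \<Theta> =
    (dhalf C (\<eta>\<^sup>2 / 2) + \<eta> * (\<eta> * dhalf (dhalf C) (\<eta>\<^sup>2 / 2))) / dhalf C (\<eta>\<^sup>2 / 2)"
proof -
  define D where "D = dhalf C (\<eta>\<^sup>2 / 2)"
  define N where "N = D + \<eta> * (\<eta> * dhalf (dhalf C) (\<eta>\<^sup>2 / 2))"
  have "- (\<eta> * D) / C 0 - N / dhalf C 0 * \<Theta> = 0"
    unfolding N_def D_def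
  proof (rule DERIV_local_min[OF DERIV_q_rfd[OF C2]])
    show "\<forall>y. \<bar>\<eta> - y\<bar> < 1 \<longrightarrow> q_rfd C \<Theta> \<eta> \<le> q_rfd C \<Theta> y"
      using step by (auto simp: is_rfd_step_def is_arg_min_def not_less)
  qed simp
  then have "\<eta> * D * - dhalf C 0 = N * \<Theta> * C 0"
    using C0 C'0 by (simp add: field_simps)
  moreover have "D \<noteq> 0"
    using nz by (simp add: D_def)
  ultimately have "\<eta> / (\<Theta> * C 0 / - dhalf C 0) = N / D"
    using C0 C'0 \<Theta> by (simp add: field_simps)
  then show ?thesis
    by (simp add: arfd_step_eq[OF C2 C0 C'0] N_def D_def)
qed

section \<open>Asymptotic equality of the step sizes\<close>

theorem proposition5p2:
  fixes M :: "'a measure"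
    and J :: "real ^ 'd \<Rightarrow> 'a \<Rightarrow> real"
    and G :: "real ^ 'd \<Rightarrow> 'a \<Rightarrow> real ^ 'd"
    and C :: "real \<Rightarrow> real"
    and \<mu> \<eta>0 \<rho> :: real
  assumes "prob_space M"
    and "isotropic_gaussian M J \<mu> C"
    and "has_gradient_field M J G"
    and "derivative_covariances M J G C"
    and "C2_half C"
    and "C 0 > 0"
    and "dhalf C 0 < 0"
    and "\<eta>0 > 0"
    and "0 < \<rho>" and "\<rho> < 1"
    and "\<And>\<eta>. \<eta> \<ge> \<eta>0 \<Longrightarrow> C (\<eta>\<^sup>2 / 2) / C 0 < \<rho>"
  shows "(\<forall>\<^sub>F \<Theta> in at_right 0. \<exists>\<eta>. is_rfd_step C \<Theta> \<eta>) \<and>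
    (\<forall>\<eta>star :: real \<Rightarrow> real.
       (\<forall>\<^sub>F \<Theta> in at_right 0. is_rfd_step C \<Theta> (\<eta>star \<Theta>)) \<longrightarrow>
       ((\<lambda>\<Theta>. \<eta>star \<Theta> / arfd_step C \<Theta>) \<longlongrightarrow> 1) (at_right 0))"
proof -
  note J = assms(2) and C2 = assms(5) and C0 = assms(6) and C'0 = assms(7)
  have near: "\<forall>\<^sub>F \<Theta> in at_right 0. \<forall>\<eta>. \<epsilon> \<le> \<bar>\<eta>\<bar> \<longrightarrow> q_rfd C \<Theta> \<eta> > - 1" if "\<epsilon> > 0" for \<epsilon>
    using C2_half_continuous(1)[OF C2] C0
      covariance_lt_variance[OF J C0 \<open>\<rho> < 1\<close> assms(11)] \<open>\<rho> < 1\<close> assms(11)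
      slope_bounded[OF J assms(4) C2 C0 C'0] that
    by (rule q_rfd_gt_away_from_0)
  have ex: "\<forall>\<^sub>F \<Theta> in at_right 0. \<exists>\<eta>. is_rfd_step C \<Theta> \<eta>"
    using near[OF zero_less_one]
  proof eventually_elim
    case (elim \<Theta>)
    then show ?case
      by (intro ex_rfd_step[OF C2 C0, of 1]) auto
  qed
  have lim: "((\<lambda>\<Theta>. \<eta>star \<Theta> / arfd_step C \<Theta>) \<longlongrightarrow> 1) (at_right 0)"
    if star: "\<forall>\<^sub>F \<Theta> in at_right 0. is_rfd_step C \<Theta> (\<eta>star \<Theta>)" for \<eta>star :: "real \<Rightarrow> real"
  proof -
    have star0: "(\<eta>star \<longlongrightarrow> 0) (at_right 0)"
    proof (rule tendstoI)
      fix \<epsilon> :: real assume "\<epsilon> > 0"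
      from star near[OF this] show "\<forall>\<^sub>F \<Theta> in at_right 0. dist (\<eta>star \<Theta>) 0 < \<epsilon>"
      proof eventually_elim
        case (elim \<Theta>)
        from elim(1) have "q_rfd C \<Theta> (\<eta>star \<Theta>) \<le> - 1"
          using q_rfd_0[of C \<Theta>] C0
          by (auto simp: is_rfd_step_def is_arg_min_def not_less dest: spec[of _ 0])
        with elim(2) show ?case
          by (force simp: not_less[symmetric])
      qed
    qed
    define h where "h = (\<lambda>\<eta>. (dhalf C (\<eta>\<^sup>2 / 2) + \<eta> * (\<eta> * dhalf (dhalf C) (\<eta>\<^sup>2 / 2)))
      / dhalf C (\<eta>\<^sup>2 / 2))"
    have cont: "isCont (\<lambda>\<eta>. dhalf C (\<eta>\<^sup>2 / 2)) 0" "isCont (\<lambda>\<eta>. dhalf (dhalf C) (\<eta>\<^sup>2 / 2)) 0"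
      using C2_half_continuous(2,3)[OF C2, THEN continuous_on_half_square]
      by (simp_all add: continuous_on_eq_continuous_at)
    have "isCont h 0"
      unfolding h_def by (rule continuous_intros cont)+ (use C'0 in simp)
    then have "((\<lambda>\<Theta>. h (\<eta>star \<Theta>)) \<longlongrightarrow> h 0) (at_right 0)"
      using star0 by (rule isCont_tendsto_compose)
    moreover have "h 0 = 1"
      using C'0 by (simp add: h_def)
    moreover have "\<forall>\<^sub>F \<Theta> in at_right 0. h (\<eta>star \<Theta>) = \<eta>star \<Theta> / arfd_step C \<Theta>"
    proof -
      have "((\<lambda>\<Theta>. dhalf C ((\<eta>star \<Theta>)\<^sup>2 / 2)) \<longlongrightarrow> dhalf C 0) (at_right 0)"
        using isCont_tendsto_compose[OF cont(1) star0] by simp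
      then have "\<forall>\<^sub>F \<Theta> in at_right 0. dhalf C ((\<eta>star \<Theta>)\<^sup>2 / 2) < 0"
        using C'0 by (auto dest: order_tendstoD(2))
      moreover have "\<forall>\<^sub>F \<Theta>::real in at_right 0. \<Theta> > 0"
        by (simp add: eventually_at_filter)
      ultimately show ?thesis
        using star
      proof eventually_elim
        case (elim \<Theta>)
        then show ?case
          unfolding h_def by (intro rfd_step_ratio[OF C2 C0 C'0, symmetric]) auto
      qed
    qed
    ultimately show ?thesis
      by (simp add: tendsto_cong)
  qed
  from ex lim show ?thesis by blast
qed

end
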